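(* (Termination.) For every counter system $M$ of disjunctive templates $A,B$, every finite $ERR\subseteq S$ and every propositional formula $\mathit{initConstr}$ over $\delta$ having $TRConstr$ as a conjunct, the procedure ParamRepair$(M,ERR,\mathit{initConstr})$ terminates.
   Context: Disjunctive templates: $Q_A,Q_B$ disjoint finite sets, $Q=Q_A\cup Q_B$; $U=(Q_U,\mathit{init}_U,\mathcal G_U,\delta_U)$, $U\in\{A,B\}$, with guards $\mathcal G_U\subseteq\mathcal P(Q)$ and total $\delta_U\subseteq Q_U\times\mathcal G_U\times Q_U$; $\delta=\delta_A\cup\delta_B$, $\delta_U(q)$ the outgoing transitions of $q$. Counter system $M=(S,S_0,\Delta)$: $S=Q_A\times\mathbb N_0^{|B|}$, $S_0=\{(\mathit{init}_A,\vec c)\mid\vec c(q)=0\text{ for }q\ne\mathit{init}_B\}$; $s\xrightarrow{t}s'$ iff (1) $t=(q_A,g,q'_A)\in\delta_A$, $s=(q_A,\vec c)$, $s'=(q'_A,\vec c)$, some $q_i\in g\cap Q_B$ has $\vec c(i)\ge1$; or (2) $t=(q_i,g,q_j)\in\delta_B$, $s=(q_A,\vec c)$, $s'=(q_A,\vec c-\vec u_i+\vec u_j)$, $\vec c(i)\ge1$, and ($q_A\in g$, or some $q_l\in g\cap Q_B$, $l\ne i$, with $\vec c(l)\ge1$, or $q_i\in g$, $\vec c(i)\ge2$). $\mathrm{Restrict}(M,\delta')$ is defined the same way using only transitions in $\delta'\subseteq\delta$. Order $(q_A,\vec c)\lessapprox(q'_A,\vec d)$ iff $q_A=q'_A$,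 $\vec c\le\vec d$; ${\uparrow}$ upward closure; $\mathit{minBasis}$ minimal elements; $\mathit{pred}$/$\mathit{Succ}$ one-step predecessors/successors in the current system. Elements of $\delta$ are propositional variables; $\delta'\subseteq\delta$ is identified with the assignment making exactly $\delta'$ true. $TRConstr=\bigwedge_{q\in Q_A}\bigvee_{t\in\delta_A(q)}t\wedge\bigwedge_{q\in Q_B}\bigvee_{t\in\delta_B(q)}t$. ModelCheck$(M')$: $E_0=ERR$, $\mathit{temp}=ERR$, $\mathit{visited}=\emptyset$, $i=1$; while $\mathit{temp}\ne\mathit{visited}$: $\mathit{visited}:=\mathit{temp}$; $E_i:=\mathit{minBasis}(\mathit{pred}({\uparrow}E_{i-1}))$ in $M'$; if $E_i\cap S_0\ne\emptyset$ return (False, $E_0,\dots,E_{i-1},E_i\cap S_0$); $\mathit{temp}:=\mathit{minBasis}(\mathit{visited}\cup E_i)$; $i:=i+1$; then return True. ParamRepair$(M,ERR,\mathit{initConstr})$: $M':=M$, $\delta':=\delta$, $\mathit{acc}:=\mathit{true}$; loop: if ModelCheck$(M')$ returns True, return $\delta'$; else with $E_0,\dots,E_k$ set $RE_k:=E_k$, $RE_{i-1}:=\mathit{Succ}(RE_i)\cap{\uparrow}E_{i-1}$ (in $M'$), $\mathit{acc}:=\bigwedge_{s\in RE_k}\mathrm{BC}(s,[RE_{k-1},\dots,RE_0])\wedge\mathit{acc}$; if $\mathit{acc}\wedge\mathit{initConstr}$ is unsatisfiable return "Unrealizable"; else let $\delta'$ be a satisfying assignment and $M':=\mathrm{Restrict}(M,\delta')$.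 $\mathrm{BC}(s,[X_1,\dots,X_m])$: let $L$ be the local transitions $t$ enabled in $s$ in $M'$ with $s\xrightarrow{t}s_t\in X_1$; if $m=1$ return $\bigwedge_{t\in L}\neg t$, else $\bigwedge_{t\in L}(\neg t\vee\mathrm{BC}(s_t,[X_2,\dots,X_m]))$. *)

theory Defs
  imports Main "HOL-Library.FSet"
begin

subsection \<open>Propositional formulas\<close>

datatype (atoms: 'v) form =
    Var 'v
  | Neg "'v form"
  | Conj "'v form fset"
  | Disj "'v form fset"

abbreviation And :: "'v form \<Rightarrow> 'v form \<Rightarrow> 'v form" where
  "And \<phi> \<psi> \<equiv> Conj {|\<phi>, \<psi>|}"

abbreviation Or :: "'v form \<Rightarrow> 'v form \<Rightarrow> 'v form" where
  "Or \<phi> \<psi> \<equiv> Disj {|\<phi>, \<psi>|}"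

abbreviation Tr :: "'v form" where
  "Tr \<equiv> Conj {||}"

text \<open>\<open>Abs_fset\<close> is only meaningful on finite sets; every index set used below is finite
  (see \<open>sat_BigAnd\<close>, \<open>sat_BigOr\<close>).\<close>

definition BigAnd :: "'i set \<Rightarrow> ('i \<Rightarrow> 'v form) \<Rightarrow> 'v form" where
  "BigAnd I f = Conj (Abs_fset (f ` I))"

definition BigOr :: "'i set \<Rightarrow> ('i \<Rightarrow> 'v form) \<Rightarrow> 'v form" where
  "BigOr I f = Disj (Abs_fset (f ` I))"

text \<open>An assignment is the set of variables that it makes true.\<close>

primrec sat :: "'v set \<Rightarrow> 'v form \<Rightarrow> bool" where
  "sat D (Var v) \<longleftrightarrow> v \<in> D"
| "sat D (Neg \<phi>) \<longleftrightarrow> \<not> sat D \<phi>"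
| "sat D (Conj F) \<longleftrightarrow> (\<forall>b \<in> fset (sat D |`| F). b)"
| "sat D (Disj F) \<longleftrightarrow> (\<exists>b \<in> fset (sat D |`| F). b)"

lemma sat_BigAnd: "finite I \<Longrightarrow> sat D (BigAnd I f) \<longleftrightarrow> (\<forall>i\<in>I. sat D (f i))"
  by (auto simp: BigAnd_def Abs_fset_inverse)

lemma sat_BigOr: "finite I \<Longrightarrow> sat D (BigOr I f) \<longleftrightarrow> (\<exists>i\<in>I. sat D (f i))"
  by (auto simp: BigOr_def Abs_fset_inverse)

inductive is_conjunct :: "'v form \<Rightarrow> 'v form \<Rightarrow> bool" where
  self: "is_conjunct \<phi> \<phi>"
| member: "is_conjunct \<phi> \<psi> \<Longrightarrow> \<psi> |\<in>| F \<Longrightarrow> is_conjunct \<phi> (Conj F)"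


subsection \<open>Disjunctive templates and their counter system\<close>

type_synonym 'q local_trans = "'q \<times> 'q set \<times> 'q"

record 'q template =
  locs :: "'q set"
  initial :: 'q
  guards :: "'q set set"
  delta :: "'q local_trans set"

definition is_template :: "'q set \<Rightarrow> 'q template \<Rightarrow> bool" where
  "is_template Q U \<longleftrightarrow>
     finite (locs U) \<and> initial U \<in> locs U \<and> guards U \<subseteq> Pow Q \<and>
     delta U \<subseteq> locs U \<times> guards U \<times> locs U \<and>
     (\<forall>q\<in>locs U. \<exists>g q'. (q, g, q') \<in> delta U)"

definition disjunctive_templates :: "'q template \<Rightarrow> 'q template \<Rightarrow> bool" where
  "disjunctive_templates A B \<longleftrightarrow>
     locs A \<inter> locs B = {} \<and>
     is_template (locs A \<union> locs B) A \<and> is_template (locs A \<union> locs B) B"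

definition all_delta :: "'q template \<Rightarrow> 'q template \<Rightarrow> 'q local_trans set" where
  "all_delta A B = delta A \<union> delta B"

text \<open>A counter vector indexed by \<open>locs B\<close> is a function on \<open>'q\<close> that vanishes
  outside \<open>locs B\<close>.\<close>

type_synonym 'q gstate = "'q \<times> ('q \<Rightarrow> nat)"

definition gstates :: "'q template \<Rightarrow> 'q template \<Rightarrow> 'q gstate set" where
  "gstates A B = {(qA, c). qA \<in> locs A \<and> (\<forall>q. q \<notin> locs B \<longrightarrow> c q = 0)}"

definition init_gstates :: "'q template \<Rightarrow> 'q template \<Rightarrow> 'q gstate set" where
  "init_gstates A B =
     {(qA, c) \<in> gstates A B. qA = initial A \<and> (\<forall>q. q \<noteq> initial B \<longrightarrow> c q = 0)}"

definition unit_vec :: "'q \<Rightarrow> 'q \<Rightarrow> nat" where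
  "unit_vec i = (\<lambda>l. if l = i then 1 else 0)"

inductive gstep ::
  "'q template \<Rightarrow> 'q template \<Rightarrow> 'q gstate \<Rightarrow> 'q local_trans \<Rightarrow> 'q gstate \<Rightarrow> bool"
  for A B where
  step_A: "(qA, c) \<in> gstates A B \<Longrightarrow> (qA, g, qA') \<in> delta A \<Longrightarrow>
     \<exists>i \<in> g \<inter> locs B. c i \<ge> 1 \<Longrightarrow>
     gstep A B (qA, c) (qA, g, qA') (qA', c)"
| step_B: "(qA, c) \<in> gstates A B \<Longrightarrow> (i, g, j) \<in> delta B \<Longrightarrow> c i \<ge> 1 \<Longrightarrow>
     qA \<in> g \<or> (\<exists>l \<in> g \<inter> locs B. l \<noteq> i \<and> c l \<ge> 1) \<or> (i \<in> g \<and> c i \<ge> 2) \<Longrightarrow>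
     gstep A B (qA, c) (i, g, j) (qA, \<lambda>l. c l - unit_vec i l + unit_vec j l)"

text \<open>The counter system restricted to \<open>D\<close>, given by its labelled transition relation; the
  unrestricted system is the case \<open>D = all_delta A B\<close>.\<close>

type_synonym 'q gsystem = "('q gstate \<times> 'q local_trans \<times> 'q gstate) set"

definition Restrict :: "'q template \<Rightarrow> 'q template \<Rightarrow> 'q local_trans set \<Rightarrow> 'q gsystem" where
  "Restrict A B D = {(s, t, s'). t \<in> D \<and> gstep A B s t s'}"

definition gpred :: "'q gsystem \<Rightarrow> 'q gstate set \<Rightarrow> 'q gstate set" where
  "gpred R X = {s. \<exists>t. \<exists>s'\<in>X. (s, t, s') \<in> R}"

definition gsucc :: "'q gsystem \<Rightarrow> 'q gstate set \<Rightarrow> 'q gstate set" where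
  "gsucc R X = {s'. \<exists>s\<in>X. \<exists>t. (s, t, s') \<in> R}"

definition gle :: "'q gstate \<Rightarrow> 'q gstate \<Rightarrow> bool" where
  "gle s s' \<longleftrightarrow> fst s = fst s' \<and> (\<forall>q. snd s q \<le> snd s' q)"

definition up :: "'q template \<Rightarrow> 'q template \<Rightarrow> 'q gstate set \<Rightarrow> 'q gstate set" where
  "up A B X = {s \<in> gstates A B. \<exists>x\<in>X. gle x s}"

definition minBasis :: "'q gstate set \<Rightarrow> 'q gstate set" where
  "minBasis X = {s \<in> X. \<forall>x\<in>X. gle x s \<longrightarrow> x = s}"


subsection \<open>Constraints\<close>

definition TRConstr :: "'q template \<Rightarrow> 'q template \<Rightarrow> 'q local_trans form" where
  "TRConstr A B =
     And (BigAnd (locs A) (\<lambda>q. BigOr {t \<in> delta A. fst t = q} Var))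
         (BigAnd (locs B) (\<lambda>q. BigOr {t \<in> delta B. fst t = q} Var))"

text \<open>In a system \<open>R\<close> arising from disjunctive templates, \<open>s\<close> and \<open>t\<close> determine the target
  \<open>s'\<close>, so ranging over the pairs \<open>(t, s')\<close> below amounts to ranging over \<open>t\<close>.
  The empty list never occurs in the procedure.\<close>

fun BC :: "'q gsystem \<Rightarrow> 'q gstate \<Rightarrow> 'q gstate set list \<Rightarrow> 'q local_trans form" where
  "BC R s [] = Tr"
| "BC R s [X] = BigAnd {t. \<exists>s'\<in>X. (s, t, s') \<in> R} (\<lambda>t. Neg (Var t))"
| "BC R s (X # Y # Xs) =
     BigAnd {(t, s'). (s, t, s') \<in> R \<and> s' \<in> X}
       (\<lambda>(t, s'). Or (Neg (Var t)) (BC R s' (Y # Xs)))"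

text \<open>From \<open>RE\<^sub>k\<close> and \<open>[E\<^sub>k\<^sub>-\<^sub>1, \<dots>, E\<^sub>0]\<close> to \<open>[RE\<^sub>k\<^sub>-\<^sub>1, \<dots>, RE\<^sub>0]\<close>.\<close>

primrec reach_errs :: "'q template \<Rightarrow> 'q template \<Rightarrow> 'q gsystem \<Rightarrow>
    'q gstate set \<Rightarrow> 'q gstate set list \<Rightarrow> 'q gstate set list" where
  "reach_errs A B R RE [] = []"
| "reach_errs A B R RE (E # Es) =
     (let RE' = gsucc R RE \<inter> up A B E in RE' # reach_errs A B R RE' Es)"


subsection \<open>The repair procedure\<close>

text \<open>The procedure is a transition system on configurations. In all of them \<open>D\<close> is the current
  \<open>\<delta>'\<close>, which determines the current system \<open>Restrict A B D\<close>.
  \<^item> \<open>Loop D acc\<close>: head of the repair loop.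
  \<^item> \<open>Check D acc temp visited Es\<close>: head of the while loop of the model checker, where \<open>Es\<close>
    is \<open>[E\<^sub>i\<^sub>-\<^sub>1, \<dots>, E\<^sub>0]\<close>.
  \<^item> \<open>Cex D acc Ek Es\<close>: the model checker returned False with final set \<open>Ek\<close> and
    \<open>Es = [E\<^sub>k\<^sub>-\<^sub>1, \<dots>, E\<^sub>0]\<close>.\<close>

datatype 'q outcome = Repaired "'q local_trans set" | Unrealizable

datatype 'q config =
    Loop "'q local_trans set" "'q local_trans form"
  | Check "'q local_trans set" "'q local_trans form"
      "'q gstate set" "'q gstate set" "'q gstate set list"
  | Cex "'q local_trans set" "'q local_trans form" "'q gstate set" "'q gstate set list"
  | Return "'q outcome"

definition new_acc :: "'q template \<Rightarrow> 'q template \<Rightarrow> 'q local_trans set \<Rightarrow>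
    'q local_trans form \<Rightarrow> 'q gstate set \<Rightarrow> 'q gstate set list \<Rightarrow> 'q local_trans form" where
  "new_acc A B D acc Ek Es =
     (let R = Restrict A B D
      in And (BigAnd Ek (\<lambda>s. BC R s (reach_errs A B R Ek Es))) acc)"

text \<open>A rule that computes sets of states fires only if these sets are finite: an infinite
  intermediate result makes the procedure get stuck, which \<open>terminates\<close> excludes.
  The rule \<open>restrict\<close> is nondeterministic, as any satisfying assignment may be chosen.\<close>

inductive repair_step :: "'q template \<Rightarrow> 'q template \<Rightarrow> 'q gstate set \<Rightarrow>
    'q local_trans form \<Rightarrow> 'q config \<Rightarrow> 'q config \<Rightarrow> bool"
  for A B ERR initConstr where
  call: "repair_step A B ERR initConstr (Loop D acc) (Check D acc ERR {} [ERR])"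
| iterate: "temp \<noteq> visited \<Longrightarrow>
     E' = minBasis (gpred (Restrict A B D) (up A B E)) \<Longrightarrow> finite E' \<Longrightarrow>
     E' \<inter> init_gstates A B = {} \<Longrightarrow>
     repair_step A B ERR initConstr
       (Check D acc temp visited (E # Es))
       (Check D acc (minBasis (temp \<union> E')) temp (E' # E # Es))"
| unsafe: "temp \<noteq> visited \<Longrightarrow>
     E' = minBasis (gpred (Restrict A B D) (up A B E)) \<Longrightarrow> finite E' \<Longrightarrow>
     E' \<inter> init_gstates A B \<noteq> {} \<Longrightarrow>
     repair_step A B ERR initConstr
       (Check D acc temp visited (E # Es))
       (Cex D acc (E' \<inter> init_gstates A B) (E # Es))"
| safe: "temp = visited \<Longrightarrow>
     repair_step A B ERR initConstr (Check D acc temp visited Es) (Return (Repaired D))"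
| restrict: "\<forall>X \<in> set (reach_errs A B (Restrict A B D) Ek Es). finite X \<Longrightarrow>
     acc' = new_acc A B D acc Ek Es \<Longrightarrow>
     D' \<subseteq> all_delta A B \<Longrightarrow> sat D' (And acc' initConstr) \<Longrightarrow>
     repair_step A B ERR initConstr (Cex D acc Ek Es) (Loop D' acc')"
| unrealizable: "\<forall>X \<in> set (reach_errs A B (Restrict A B D) Ek Es). finite X \<Longrightarrow>
     acc' = new_acc A B D acc Ek Es \<Longrightarrow>
     \<nexists>D'. D' \<subseteq> all_delta A B \<and> sat D' (And acc' initConstr) \<Longrightarrow>
     repair_step A B ERR initConstr (Cex D acc Ek Es) (Return Unrealizable)"

definition repair_start :: "'q template \<Rightarrow> 'q template \<Rightarrow> 'q config" where
  "repair_start A B = Loop (all_delta A B) Tr"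

text \<open>Every execution is finite, and can only end by returning an outcome.\<close>

definition terminates :: "('q config \<Rightarrow> 'q config \<Rightarrow> bool) \<Rightarrow> 'q config \<Rightarrow> bool" where
  "terminates step start \<longleftrightarrow>
     (\<nexists>f :: nat \<Rightarrow> 'q config. f 0 = start \<and> (\<forall>n. step (f n) (f (Suc n)))) \<and>
     (\<forall>c. step\<^sup>*\<^sup>* start c \<and> (\<nexists>c'. step c c') \<longrightarrow> (\<exists>r. c = Return r))"

end

theory Submission
  imports Defs HOL.Topological_Spaces "HOL-Library.Infinite_Set"
begin

text \<open>Two well-founded quantities bound an execution. First, every counterexample found in
  \<open>Restrict A B D\<close> yields a constraint that \<open>D\<close> itself violates: by compatibility of the steps
  with the order on global states, an initial state of \<open>E\<^sub>k\<close> starts a path of the restricted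
  system through \<open>RE\<^sub>k\<^sub>-\<^sub>1, \<dots>, RE\<^sub>0\<close>, and all labels of this path lie in \<open>D\<close>. As \<open>D\<close> satisfies the
  constraints accumulated before, their finite set of models shrinks strictly. Second, within
  one run of the model checker the upward closure of \<open>temp\<close> grows, which by Dickson's lemma
  happens only finitely often; once \<open>temp\<close> is a minimal basis and its upward closure does not
  grow, \<open>temp\<close> itself does not change, so the loop is left.\<close>

section \<open>Termination from a well-founded rank\<close>

text \<open>An infinite execution would be mapped by \<open>\<mu>\<close> to an infinite descending
  chain of \<open>r\<close>. Reachable configurations satisfy \<open>I\<close>, so
  \<open>progress\<close> lets only a \<open>Return\<close> be final.\<close>

lemma terminatesI:
  fixes step :: "'a config \<Rightarrow> 'a config \<Rightarrow> bool"
  assumes wf: "wf r" and start: "I start"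
    and dec: "\<And>c c'. I c \<Longrightarrow> step c c' \<Longrightarrow> I c' \<and> (\<mu> c', \<mu> c) \<in> r"
    and progress: "\<And>c. I c \<Longrightarrow> (\<exists>c'. step c c') \<or> (\<exists>r. c = Return r)"
  shows "terminates step start"
  unfolding terminates_def
proof (intro conjI allI impI notI)
  assume "\<exists>f :: nat \<Rightarrow> 'a config. f 0 = start \<and> (\<forall>n. step (f n) (f (Suc n)))"
  then obtain f :: "nat \<Rightarrow> 'a config" where f: "f 0 = start" "\<And>n. step (f n) (f (Suc n))"
    by blast
  have inv: "I (f n)" for n
    by (induction n) (use f start dec in auto)
  then have "\<forall>n. ((\<mu> \<circ> f) (Suc n), (\<mu> \<circ> f) n) \<in> r"
    using dec f(2) by simp
  then show False
    using wf unfolding wf_iff_no_infinite_down_chain by blast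
next
  fix c assume c: "step\<^sup>*\<^sup>* start c \<and> (\<nexists>c'. step c c')"
  have "step\<^sup>*\<^sup>* start c \<Longrightarrow> I c"
    by (induction rule: rtranclp_induct) (use start dec in auto)
  then show "\<exists>r. c = Return r"
    using c progress by blast
qed

text \<open>The defining equations of \<open>BC\<close> split off two list elements, while the
  induction over the error sets knows only that the tail is nonempty.\<close>

lemma BC_Cons:
  assumes "Xs \<noteq> []"
  shows "BC R s (X # Xs) =
    BigAnd {(t, s'). (s, t, s') \<in> R \<and> s' \<in> X} (\<lambda>(t, s'). Or (Neg (Var t)) (BC R s' Xs))"
  using assms by (cases Xs) auto

lemma reach_errs_eq_Nil_iff [simp]: "reach_errs A B R RE Es = [] \<longleftrightarrow> Es = []"
  by (cases Es) (auto simp: Let_def)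

subsection \<open>Dickson's lemma\<close>

text \<open>Every sequence has a monotone subsequence. If that one decreases, it is constant once it
  has attained its least value, and a tail of it serves.\<close>

lemma nat_seq_mono_subseq:
  fixes f :: "nat \<Rightarrow> nat"
  obtains r :: "nat \<Rightarrow> nat" where "strict_mono r" "mono (f \<circ> r)"
proof -
  obtain r where r: "strict_mono r" "monoseq (\<lambda>n. f (r n))"
    using seq_monosub by blast
  consider "\<forall>m n. m \<le> n \<longrightarrow> f (r m) \<le> f (r n)" | "\<forall>m n. m \<le> n \<longrightarrow> f (r n) \<le> f (r m)"
    using r(2) unfolding monoseq_def by blast
  then show ?thesis
  proof cases
    case 1
    then show ?thesis
      using that[OF r(1)] by (simp add: mono_def)
  next
    case 2
    define v where "v = (LEAST v. \<exists>k. f (r k) = v)"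
    obtain k where k: "f (r k) = v"
      using LeastI[of "\<lambda>v. \<exists>k. f (r k) = v" "f (r 0)"] unfolding v_def by blast
    have v_le: "v \<le> f (r n)" for n
      unfolding v_def by (rule Least_le) auto
    have const: "f (r (n + k)) = v" for n
      using 2[rule_format, of k "n + k"] k v_le[of "n + k"] by simp
    have "strict_mono (\<lambda>n. r (n + k))"
      using r(1) by (simp add: strict_mono_def)
    then show ?thesis
      by (rule that) (simp add: const mono_def)
  qed
qed

text \<open>The sequence is thinned out once per coordinate; passing to a further subsequence
  preserves the monotonicity already gained.\<close>

lemma seq_pointwise_mono_subseq:
  fixes f :: "nat \<Rightarrow> 'a \<Rightarrow> nat"
  assumes "finite Q"
  shows "\<exists>r :: nat \<Rightarrow> nat. strict_mono r \<and> (\<forall>q\<in>Q. mono (\<lambda>n. f (r n) q))"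
  using assms
proof (induction Q)
  case empty
  show ?case
    by (rule exI[of _ id]) (simp add: strict_mono_def)
next
  case (insert p Q)
  then obtain r :: "nat \<Rightarrow> nat" where r: "strict_mono r" "\<forall>q\<in>Q. mono (\<lambda>n. f (r n) q)"
    by blast
  obtain r' :: "nat \<Rightarrow> nat" where r': "strict_mono r'" "mono ((\<lambda>n. f (r n) p) \<circ> r')"
    by (rule nat_seq_mono_subseq)
  have "strict_mono (r \<circ> r')"
    using r(1) r'(1) by (simp add: strict_mono_def)
  moreover have "mono (\<lambda>n. f ((r \<circ> r') n) q)" if "q \<in> insert p Q" for q
    using that r(2) r' by (auto simp: mono_def strict_mono_less_eq)
  ultimately show ?case
    by blast
qed

section \<open>The order on global states\<close>

lemma gle_refl: "gle s s"
  by (simp add: gle_def)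

lemma gle_trans: "gle s t \<Longrightarrow> gle t u \<Longrightarrow> gle s u"
  unfolding gle_def by (metis order_trans)

lemma gle_antisym: "gle s t \<Longrightarrow> gle t s \<Longrightarrow> s = t"
  unfolding gle_def by (metis antisym ext prod_eqI)

lemma minBasis_subset: "minBasis X \<subseteq> X"
  by (auto simp: minBasis_def)

lemma minBasis_idem: "minBasis (minBasis X) = minBasis X"
  by (auto simp: minBasis_def)

lemma minBasis_self_gle_eq: "minBasis X = X \<Longrightarrow> x \<in> X \<Longrightarrow> y \<in> X \<Longrightarrow> gle x y \<Longrightarrow> x = y"
  by (auto simp: minBasis_def)

locale template_pair =
  fixes A B :: "'q template"
  assumes templates: "disjunctive_templates A B"
begin

abbreviation "S \<equiv> gstates A B"

lemma finite_locs: "finite (locs A)" "finite (locs B)"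
  using templates by (auto simp: disjunctive_templates_def is_template_def)

lemma delta_subset:
  "(q, g, q') \<in> delta A \<Longrightarrow> q' \<in> locs A"
  "(q, g, q') \<in> delta B \<Longrightarrow> q \<in> locs B \<and> q' \<in> locs B"
  using templates by (auto simp: disjunctive_templates_def is_template_def)

lemma finite_all_delta: "finite (all_delta A B)"
proof -
  let ?Q = "locs A \<union> locs B"
  have "all_delta A B \<subseteq> ?Q \<times> Pow ?Q \<times> ?Q"
    using templates
    unfolding disjunctive_templates_def is_template_def all_delta_def by blast
  then show ?thesis
    by (rule finite_subset) (use finite_locs in auto)
qed

text \<open>Pigeonhole on the finite set \<open>locs A\<close> fixes the first component along a
  subsequence. A further subsequence makes all counters monotone, and its first two members are
  comparable.\<close>

lemma dickson:
  assumes "\<And>n :: nat. x n \<in> S"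
  shows "\<exists>i j. i < j \<and> gle (x i) (x j)"
proof -
  have "range (fst \<circ> x) \<subseteq> locs A"
    using assms by (auto simp: gstates_def mem_Times_iff split_beta)
  then have "finite (range (fst \<circ> x))"
    using finite_locs(1) by (rule finite_subset)
  then obtain k where k: "infinite {n. (fst \<circ> x) n = (fst \<circ> x) k}"
    using pigeonhole_infinite[of "UNIV :: nat set" "fst \<circ> x"] by auto
  define e where "e = enumerate {n. (fst \<circ> x) n = (fst \<circ> x) k}"
  have e: "strict_mono e" "fst (x (e n)) = fst (x k)" for n
    using strict_mono_enumerate[OF k] enumerate_in_set[OF k] by (auto simp: e_def)
  obtain r :: "nat \<Rightarrow> nat" where r: "strict_mono r" "\<forall>q\<in>locs B. mono (\<lambda>n. snd (x (e (r n))) q)"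
    using seq_pointwise_mono_subseq[OF finite_locs(2), of "\<lambda>n. snd (x (e n))"] by blast
  have "snd (x (e (r 0))) q \<le> snd (x (e (r 1))) q" for q
  proof (cases "q \<in> locs B")
    case True
    then show ?thesis
      using r(2) by (simp add: mono_def)
  next
    case False
    then show ?thesis
      using assms[of "e (r 0)"] by (auto simp: gstates_def)
  qed
  then have "gle (x (e (r 0))) (x (e (r 1)))"
    using e(2) by (simp add: gle_def)
  moreover have "e (r 0) < e (r 1)"
    using e(1) r(1) by (simp add: strict_mono_def)
  ultimately show ?thesis
    by blast
qed

subsection \<open>Minimal bases and upward closures\<close>

text \<open>Distinct minimal elements are incomparable, so an infinite basis would contain an
  injective sequence contradicting \<open>dickson\<close>.\<close>

lemma finite_minBasis:
  assumes "X \<subseteq> S"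
  shows "finite (minBasis X)"
proof (rule ccontr)
  assume "infinite (minBasis X)"
  then obtain x :: "nat \<Rightarrow> 'q gstate" where x: "inj x" "range x \<subseteq> minBasis X"
    using infinite_countable_subset by blast
  then have "x n \<in> S" for n
    using minBasis_subset assms by blast
  then obtain i j where ij: "i < j" "gle (x i) (x j)"
    using dickson by blast
  have "x i = x j"
    by (rule minBasis_self_gle_eq[OF minBasis_idem _ _ ij(2)]) (use x in auto)
  then show False
    using x(1) ij(1) by (auto dest: injD)
qed

text \<open>The total number of B-processes serves as a measure for the descent to a minimal
  element.\<close>

lemma gle_sum_less:
  assumes "s \<in> S" "t \<in> S" "gle s t" "s \<noteq> t"
  shows "sum (snd s) (locs B) < sum (snd t) (locs B)"
proof -
  obtain q where q: "snd s q \<noteq> snd t q"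
    using assms(3,4) unfolding gle_def by (metis ext prod_eqI)
  then have "q \<in> locs B"
    using assms(1,2) by (cases "q \<in> locs B") (auto simp: gstates_def)
  moreover have "snd s q < snd t q"
    using q assms(3) by (simp add: gle_def order_less_le)
  ultimately show ?thesis
    using assms(3) finite_locs(2) by (intro sum_strict_mono_ex1) (auto simp: gle_def)
qed

lemma minBasis_below:
  assumes "X \<subseteq> S" "x \<in> X"
  shows "\<exists>m\<in>minBasis X. gle m x"
  using assms(2)
proof (induction "sum (snd x) (locs B)" arbitrary: x rule: less_induct)
  case less
  show ?case
  proof (cases "x \<in> minBasis X")
    case True
    then show ?thesis
      using gle_refl by blast
  next
    case False
    then obtain y where y: "y \<in> X" "gle y x" "y \<noteq> x"
      using less.prems by (auto simp: minBasis_def)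
    then have "sum (snd y) (locs B) < sum (snd x) (locs B)"
      using gle_sum_less assms(1) less.prems by blast
    then show ?thesis
      using less.hyps y gle_trans by blast
  qed
qed

lemma up_minBasis:
  assumes "X \<subseteq> S"
  shows "up A B (minBasis X) = up A B X"
proof
  show "up A B (minBasis X) \<subseteq> up A B X"
    using minBasis_subset by (fastforce simp: up_def)
  show "up A B X \<subseteq> up A B (minBasis X)"
    using minBasis_below[OF assms] gle_trans unfolding up_def by blast
qed

text \<open>An element \<open>x\<close> of one basis lies above some \<open>y\<close> of the other,
  which lies above some \<open>x'\<close> of the first. Minimality gives \<open>x' = x\<close>, and
  antisymmetry \<open>y = x\<close>.\<close>

lemma minimal_basis_unique:
  assumes "X \<subseteq> S" "Y \<subseteq> S" "minBasis X = X" "minBasis Y = Y" "up A B X = up A B Y"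
  shows "X = Y"
proof -
  have sub: "X' \<subseteq> Y'" if "X' \<subseteq> S" "Y' \<subseteq> S" "minBasis X' = X'" "up A B X' = up A B Y'" for X' Y'
  proof
    fix x assume x: "x \<in> X'"
    then have "x \<in> up A B Y'"
      unfolding that(4)[symmetric] using that(1) gle_refl unfolding up_def by blast
    then obtain y where y: "y \<in> Y'" "gle y x"
      by (auto simp: up_def)
    then have "y \<in> up A B X'"
      unfolding that(4) using that(2) gle_refl unfolding up_def by blast
    then obtain x' where x': "x' \<in> X'" "gle x' y"
      by (auto simp: up_def)
    then have "x' = x"
      using minBasis_self_gle_eq[OF that(3)] x y gle_trans by blast
    then show "x \<in> Y'"
      using x' y gle_antisym by blast
  qed
  show ?thesis
    using sub[OF assms(1,2,3,5)] sub[OF assms(2,1,4) assms(5)[symmetric]] by blast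
qed

text \<open>Both sides are required to be upward closures, since strict growth of arbitrary sets of
  states need not stop. The larger set comes first, so that growth counts as descent.\<close>

definition up_growth :: "('q gstate set \<times> 'q gstate set) set" where
  "up_growth = {(U', U). U \<subset> U' \<and> (\<exists>X. U = up A B X) \<and> (\<exists>X'. U' = up A B X')}"

text \<open>Each strict growth contributes a new state \<open>x n\<close>; by \<open>dickson\<close>
  a later new state lies above an earlier one, so it was already in the closure.\<close>

lemma wf_up_growth: "wf up_growth"
  unfolding wf_iff_no_infinite_down_chain
proof
  assume "\<exists>U. \<forall>n. (U (Suc n), U n) \<in> up_growth"
  then obtain U where growth: "\<And>n. (U (Suc n), U n) \<in> up_growth"
    by blast
  have U: "U n \<subset> U (Suc n)" "\<exists>X. U n = up A B X" for n
    using growth[of n] by (simp_all add: up_growth_def)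
  have "\<exists>x. x \<in> U (Suc n) - U n" for n
    using U(1) by blast
  then obtain x where x: "\<And>n. x n \<in> U (Suc n)" "\<And>n. x n \<notin> U n"
    by (metis Diff_iff)
  have inS: "U n \<subseteq> S" for n
    using U(2)[of n] by (auto simp: up_def)
  then have "x n \<in> S" for n
    using x(1) by blast
  then obtain i j where ij: "i < j" "gle (x i) (x j)"
    using dickson by blast
  obtain X where X: "U (Suc i) = up A B X"
    using U(2) by blast
  \<comment> \<open>\<open>x i\<close> enters only at index \<open>Suc i\<close>, which is still at
    most \<open>j\<close>, whereas \<open>x j\<close> is missing from \<open>U j\<close>.\<close>
  have "x j \<in> U (Suc i)"
    using x(1)[of i] x(1)[of j] inS ij(2) gle_trans unfolding X up_def by blast
  moreover have "U (Suc i) \<subseteq> U j"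
    by (rule lift_Suc_mono_le) (use U(1) ij(1) in auto)
  ultimately show False
    using x(2) by blast
qed

subsection \<open>Steps of the counter system\<close>

lemma gstep_source: "gstep A B s t s' \<Longrightarrow> s \<in> S"
  by (auto elim: gstep.cases)

lemma gstep_target: "gstep A B s t s' \<Longrightarrow> s' \<in> S"
  by (auto elim!: gstep.cases dest!: delta_subset simp: gstates_def unit_vec_def)

text \<open>Disjunctive guards only ask for the presence of processes, so larger counters disable no
  transition. Both vectors then change by the same monotone update.\<close>

lemma gstep_compatible:
  assumes "gstep A B s t s'" "gle s u" "u \<in> S"
  shows "\<exists>u'. gstep A B u t u' \<and> gle s' u'"
  using assms(1)
proof cases
  case (step_A qA c g qA')
  obtain d where u: "u = (qA, d)" and le: "\<And>q. c q \<le> d q"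
    using assms(2) step_A by (cases u) (auto simp: gle_def)
  have "gstep A B (qA, d) (qA, g, qA') (qA', d)"
    using step_A assms(3) u le order_trans by (intro gstep.step_A) blast+
  then show ?thesis
    using step_A u le by (auto simp: gle_def)
next
  case (step_B qA c i g j)
  obtain d where u: "u = (qA, d)" and le: "\<And>q. c q \<le> d q"
    using assms(2) step_B by (cases u) (auto simp: gle_def)
  have "gstep A B (qA, d) (i, g, j) (qA, \<lambda>l. d l - unit_vec i l + unit_vec j l)"
    using step_B assms(3) u le order_trans by (intro gstep.step_B) blast+
  moreover have "gle s' (qA, \<lambda>l. d l - unit_vec i l + unit_vec j l)"
    using step_B le by (simp add: gle_def diff_le_mono)
  ultimately show ?thesis
    using step_B u by blast
qed

text \<open>A source and a label leave at most two candidate targets, one per kind of step, and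
  there are finitely many labels.\<close>

lemma finite_gsteps: "finite {(t, s'). gstep A B s t s'}"
proof -
  have "{(t, s'). gstep A B s t s'} \<subseteq>
      (\<lambda>t. (t, snd (snd t), snd s)) ` all_delta A B \<union>
      (\<lambda>t. (t, fst s, \<lambda>l. snd s l - unit_vec (fst t) l + unit_vec (snd (snd t)) l)) ` all_delta A B"
    by (auto elim!: gstep.cases simp: all_delta_def image_iff)
  then show ?thesis
    by (rule finite_subset) (simp add: finite_all_delta)
qed

lemma finite_Restrict_labels: "finite {t. \<exists>s'\<in>X. (s, t, s') \<in> Restrict A B D}"
  by (rule finite_surj[OF finite_gsteps[of s], where f = fst]) (force simp: Restrict_def)

lemma finite_Restrict_steps: "finite {(t, s'). (s, t, s') \<in> Restrict A B D \<and> s' \<in> X}"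
  by (rule finite_subset[OF _ finite_gsteps[of s]]) (auto simp: Restrict_def)

lemma finite_gsucc:
  assumes "finite X"
  shows "finite (gsucc (Restrict A B D) X)"
proof -
  have "gsucc (Restrict A B D) X \<subseteq> (\<Union>s\<in>X. snd ` {(t, s'). gstep A B s t s'})"
    by (force simp: gsucc_def Restrict_def)
  then show ?thesis
    by (rule finite_subset) (use assms finite_gsteps in auto)
qed

lemma finite_reach_errs:
  "finite RE \<Longrightarrow> \<forall>X\<in>set (reach_errs A B (Restrict A B D) RE Es). finite X"
proof (induction Es arbitrary: RE)
  case (Cons E Es)
  then have fin: "finite (gsucc (Restrict A B D) RE \<inter> up A B E)"
    using finite_gsucc by simp
  then show ?case
    using Cons.IH[OF fin] by (simp add: Let_def)
qed simp

lemma gpred_subset: "gpred (Restrict A B D) X \<subseteq> S"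
  by (auto simp: gpred_def Restrict_def dest: gstep_source)

lemma gpred_up_closed:
  assumes "s \<in> gpred (Restrict A B D) (up A B E)" "gle s u" "u \<in> S"
  shows "u \<in> gpred (Restrict A B D) (up A B E)"
proof -
  obtain t s' e where s': "t \<in> D" "gstep A B s t s'" "e \<in> E" "gle e s'"
    using assms(1) by (auto simp: gpred_def up_def Restrict_def)
  obtain u' where u': "gstep A B u t u'" "gle s' u'"
    using gstep_compatible[OF s'(2) assms(2,3)] by blast
  then have "u' \<in> up A B E"
    using s'(3,4) gstep_target gle_trans unfolding up_def by blast
  then show ?thesis
    using s'(1) u'(1) unfolding gpred_def Restrict_def by blast
qed

subsection \<open>Constraints exclude the system that caused them\<close>

text \<open>The list runs from the latest set to the first. Inclusion suffices and also covers the
  last set of a counterexample, which is cut down to initial states.\<close>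

definition error_chain :: "'q local_trans set \<Rightarrow> 'q gstate set list \<Rightarrow> bool" where
  "error_chain D = successively (\<lambda>E' E. E' \<subseteq> gpred (Restrict A B D) (up A B E))"

text \<open>One violated branch of \<open>BC\<close> is built along a forward path: each label is in
  \<open>D\<close>, so its negation fails, and the rest fails by induction. \<open>RE\<close> varies
  because it is recomputed at each position.\<close>

lemma not_sat_BC:
  assumes "Es \<noteq> []" "error_chain D Es" "s \<in> RE"
    and "s \<in> gpred (Restrict A B D) (up A B (hd Es))"
  shows "\<not> sat D (BC (Restrict A B D) s (reach_errs A B (Restrict A B D) RE Es))"
  using assms
proof (induction Es arbitrary: s RE)
  case (Cons E Es)
  let ?R = "Restrict A B D"
  let ?RE' = "gsucc ?R RE \<inter> up A B E"
  obtain t s' where t: "(s, t, s') \<in> ?R" "s' \<in> up A B E"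
    using Cons.prems(4) by (auto simp: gpred_def)
  then have s': "s' \<in> ?RE'"
    using Cons.prems(3) unfolding gsucc_def by blast
  have D: "t \<in> D"
    using t(1) by (simp add: Restrict_def)
  show ?case
  proof (cases "Es = []")
    case True
    have "t \<in> {t. \<exists>s'\<in>?RE'. (s, t, s') \<in> ?R}"
      using t(1) s' by blast
    moreover have "\<not> sat D (Neg (Var t))"
      using D by simp
    ultimately have "\<not> sat D (BigAnd {t. \<exists>s'\<in>?RE'. (s, t, s') \<in> ?R} (\<lambda>t. Neg (Var t)))"
      unfolding sat_BigAnd[OF finite_Restrict_labels] by blast
    then show ?thesis
      using True by (simp add: Let_def)
  next
    case False
    then have chain: "error_chain D Es" "E \<subseteq> gpred ?R (up A B (hd Es))"
      using Cons.prems(2) by (cases Es; simp add: error_chain_def)+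
    obtain e where "e \<in> E" "gle e s'" "s' \<in> S"
      using t(2) by (auto simp: up_def)
    \<comment> \<open>The path reaches a state that is only above some \<open>e\<close> of
      \<open>E\<close>; upward closedness of the predecessor set lets it continue from
      there.\<close>
    then have "s' \<in> gpred ?R (up A B (hd Es))"
      using gpred_up_closed chain(2) by blast
    then have "\<not> sat D (BC ?R s' (reach_errs A B ?R ?RE' Es))"
      using Cons.IH[OF False chain(1) s'] by blast
    then have "\<not> sat D (Or (Neg (Var t)) (BC ?R s' (reach_errs A B ?R ?RE' Es)))"
      using D by simp
    moreover have "(t, s') \<in> {(t, s'). (s, t, s') \<in> ?R \<and> s' \<in> ?RE'}"
      using t(1) s' by blast
    ultimately have "\<not> sat D (BigAnd {(t, s'). (s, t, s') \<in> ?R \<and> s' \<in> ?RE'}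
        (\<lambda>(t, s'). Or (Neg (Var t)) (BC ?R s' (reach_errs A B ?R ?RE' Es))))"
      unfolding sat_BigAnd[OF finite_Restrict_steps] by - (intro notI, drule (1) bspec, simp)
    then show ?thesis
      using False by (simp add: Let_def BC_Cons)
  qed
qed simp

lemma sat_new_acc: "sat D' (new_acc A B D acc Ek Es) \<Longrightarrow> sat D' acc"
  by (simp add: new_acc_def Let_def)

lemma not_sat_new_acc:
  assumes "finite Ek" "Ek \<noteq> {}" "Es \<noteq> []" "error_chain D (Ek # Es)"
  shows "\<not> sat D (new_acc A B D acc Ek Es)"
proof -
  obtain s where s: "s \<in> Ek"
    using assms(2) by blast
  have "error_chain D Es" "Ek \<subseteq> gpred (Restrict A B D) (up A B (hd Es))"
    using assms(3,4) by (cases Es; simp add: error_chain_def)+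
  then have "\<not> sat D (BC (Restrict A B D) s (reach_errs A B (Restrict A B D) Ek Es))"
    using not_sat_BC assms(3) s by blast
  then show ?thesis
    using assms(1) s by (auto simp: new_acc_def Let_def sat_BigAnd)
qed

subsection \<open>Termination of the repair procedure\<close>

text \<open>\<open>sat D acc\<close> makes the current \<open>D\<close> a model of the old
  constraint, hence one that the next counterexample removes.\<close>

fun config_inv :: "'q config \<Rightarrow> bool" where
  "config_inv (Loop D acc) \<longleftrightarrow> D \<subseteq> all_delta A B \<and> sat D acc"
| "config_inv (Check D acc temp visited Es) \<longleftrightarrow>
     D \<subseteq> all_delta A B \<and> sat D acc \<and> temp \<subseteq> S \<and> Es \<noteq> [] \<and> error_chain D Es"
| "config_inv (Cex D acc Ek Es) \<longleftrightarrow>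
     D \<subseteq> all_delta A B \<and> sat D acc \<and> finite Ek \<and> Ek \<noteq> {} \<and> Es \<noteq> [] \<and> error_chain D (Ek # Es)"
| "config_inv (Return r) \<longleftrightarrow> True"

definition models :: "'q local_trans form \<Rightarrow> 'q local_trans set set" where
  "models acc = {D. D \<subseteq> all_delta A B \<and> sat D acc}"

lemma models_new_acc_less:
  assumes "config_inv (Cex D acc Ek Es)"
  shows "card (models (new_acc A B D acc Ek Es)) < card (models acc)"
proof (rule psubset_card_mono)
  show "finite (models acc)"
    using finite_all_delta by (auto simp: models_def)
  have "D \<in> models acc" "D \<notin> models (new_acc A B D acc Ek Es)"
    using assms not_sat_new_acc by (auto simp: models_def)
  then show "models (new_acc A B D acc Ek Es) \<subset> models acc"
    using sat_new_acc by (auto simp: models_def)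
qed

text \<open>The last component covers the iterations in which the upward closure of \<open>temp\<close> stays
  the same: there are at most two, as \<open>ERR\<close> need not be a minimal basis.\<close>

fun rank :: "'q config \<Rightarrow> nat \<times> nat \<times> 'q gstate set \<times> nat" where
  "rank (Loop D acc) = (card (models acc), 3, {}, 0)"
| "rank (Check D acc temp visited Es) =
     (card (models acc), 2, up A B temp,
      if minBasis temp \<noteq> temp then 2 else if temp \<noteq> visited then 1 else 0)"
| "rank (Cex D acc Ek Es) = (card (models acc), 1, {}, 0)"
| "rank (Return r) = (0, 0, {}, 0)"

abbreviation "rank_order \<equiv> less_than <*lex*> less_than <*lex*> up_growth <*lex*> less_than"

text \<open>The second component falls along the phases of one round. Only \<open>restrict\<close>
  raises it, and there a model of \<open>acc\<close> is lost.\<close>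

lemma repair_step_decreases:
  assumes "repair_step A B ERR initConstr c c'" "config_inv c" "ERR \<subseteq> S"
  shows "config_inv c' \<and> (rank c', rank c) \<in> rank_order"
  using assms(1)
proof cases
  case (call D acc)
  then show ?thesis
    using assms(2,3) by (simp add: error_chain_def)
next
  case (iterate temp visited E' D E acc Es)
  have temp: "temp \<subseteq> S" and E': "E' \<subseteq> gpred (Restrict A B D) (up A B E)"
    using assms(2) iterate minBasis_subset by auto
  then have sub: "temp \<union> E' \<subseteq> S"
    using gpred_subset by blast
  let ?temp' = "minBasis (temp \<union> E')"
  have temp': "?temp' \<subseteq> S" "minBasis ?temp' = ?temp'"
    using sub minBasis_subset minBasis_idem by blast+
  have inv: "config_inv c'"
    using assms(2) iterate temp'(1) E' by (simp add: error_chain_def)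
  have "up A B temp \<subseteq> up A B ?temp'"
    unfolding up_minBasis[OF sub] by (auto simp: up_def)
  then consider "up A B temp \<subset> up A B ?temp'" | "up A B ?temp' = up A B temp"
    by blast
  then have "(rank c', rank c) \<in> rank_order"
  proof cases
    case 1
    then show ?thesis
      using iterate by (auto simp: up_growth_def)
  next
    case 2
    \<comment> \<open>If \<open>temp\<close> is already minimal, the next configuration has
      \<open>temp = visited\<close> and the last component falls from 1 to 0. Otherwise it falls
      from 2 to at most 1, as the new set is minimal.\<close>
    then have "minBasis temp = temp \<Longrightarrow> ?temp' = temp"
      using minimal_basis_unique[OF temp'(1) temp temp'(2)] by blast
    then show ?thesis
      using iterate 2 temp'(2) by auto
  qed
  then show ?thesis
    using inv by blast
next
  case (unsafe temp visited E' D E acc Es)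
  have "E' \<subseteq> gpred (Restrict A B D) (up A B E)"
    using unsafe minBasis_subset by auto
  then show ?thesis
    using assms(2) unsafe by (auto simp: error_chain_def)
next
  case (safe temp visited D acc Es)
  then show ?thesis
    by auto
next
  case (restrict D Ek Es acc' acc D')
  then have "card (models acc') < card (models acc)"
    using assms(2) models_new_acc_less by simp
  then show ?thesis
    using restrict by simp
next
  case (unrealizable D Ek Es acc' acc)
  then show ?thesis
    by auto
qed

text \<open>The finiteness premises of the rules always hold: minimal bases are finite by
  \<open>dickson\<close>, and the error sets by finite branching from the finite
  \<open>Ek\<close>.\<close>

lemma repair_progress:
  assumes "config_inv c"
  shows "(\<exists>c'. repair_step A B ERR initConstr c c') \<or> (\<exists>r. c = Return r)"
proof (cases c)
  case (Loop D acc)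
  then show ?thesis
    using repair_step.call by blast
next
  case (Check D acc temp visited Es)
  then obtain E Es' where Es: "Es = E # Es'"
    using assms by (cases Es) auto
  let ?E' = "minBasis (gpred (Restrict A B D) (up A B E))"
  have fin: "finite ?E'"
    using finite_minBasis gpred_subset by blast
  consider "temp = visited" | "temp \<noteq> visited" "?E' \<inter> init_gstates A B = {}"
    | "temp \<noteq> visited" "?E' \<inter> init_gstates A B \<noteq> {}"
    by blast
  then show ?thesis
  proof cases
    case 1
    show ?thesis
      unfolding Check Es by (rule disjI1, rule exI, rule repair_step.safe[OF 1])
  next
    case 2
    show ?thesis
      unfolding Check Es by (rule disjI1, rule exI, rule repair_step.iterate[OF 2(1) refl fin 2(2)])
  next
    case 3
    show ?thesis
      unfolding Check Es by (rule disjI1, rule exI, rule repair_step.unsafe[OF 3(1) refl fin 3(2)])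
  qed
next
  case (Cex D acc Ek Es)
  then have "finite Ek"
    using assms by simp
  note fin = finite_reach_errs[OF this, of D Es]
  show ?thesis
  proof (cases "\<exists>D' \<subseteq> all_delta A B. sat D' (And (new_acc A B D acc Ek Es) initConstr)")
    case True
    then obtain D' where D': "D' \<subseteq> all_delta A B"
        "sat D' (And (new_acc A B D acc Ek Es) initConstr)"
      by blast
    show ?thesis
      unfolding Cex by (rule disjI1, rule exI, rule repair_step.restrict[OF fin refl D'])
  next
    case False
    show ?thesis
      unfolding Cex by (rule disjI1, rule exI, rule repair_step.unrealizable[OF fin refl False])
  qed
qed simp

end

theorem theorem4:
  fixes A B :: "'q template"
    and ERR :: "'q gstate set"
    and initConstr :: "'q local_trans form"
  assumes "disjunctive_templates A B"
    and "finite ERR" and "ERR \<subseteq> gstates A B"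
    and "atoms initConstr \<subseteq> all_delta A B"
    and "is_conjunct (TRConstr A B) initConstr"
  shows "terminates (repair_step A B ERR initConstr) (repair_start A B)"
proof -
  interpret template_pair A B
    by unfold_locales (rule assms(1))
  show ?thesis
  proof (rule terminatesI[of rank_order config_inv _ _ rank])
    show "wf rank_order"
      by (intro wf_lex_prod wf_less_than wf_up_growth)
    show "config_inv (repair_start A B)"
      by (simp add: repair_start_def)
    show "config_inv c' \<and> (rank c', rank c) \<in> rank_order"
      if "config_inv c" "repair_step A B ERR initConstr c c'" for c c'
      using repair_step_decreases[OF that(2,1) assms(3)] .
  qed (rule repair_progress)
qed

end
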